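(* Let $n\ge 2$, $a_1,\dots,a_n\in(0,1)$, $\vec{a}=(a_1,\dots,a_n)'$, and let $R=\mathrm{Diag}(1-a_1^2,\dots,1-a_n^2)+\vec{a}\,\vec{a}'$. Then for every $\alpha>0$ the cumulative distribution function $F$ of the $\Gamma_n(\alpha,R)$-distribution is MTP$_2$ on $(0,\infty)^n$. Consequently, if $(X_1,\dots,X_n)$ has the $\Gamma_n(\alpha,R)$-distribution, then for all $0<x_i\le b_i$ $(i=1,\dots,n)$ and every nonempty proper subset $I\subset\{1,\dots,n\}$, with $A_i=\{X_i\le x_i\}$ and $B_i=\{X_i\le b_i\}$, $$\frac{P\left(\bigcap_{i=1}^n A_i\right)}{P\left(\bigcap_{i\in I}A_i\right)P\left(\bigcap_{i\notin I}A_i\right)}\ \ge\ \frac{P\left(\bigcap_{i=1}^n B_i\right)}{P\left(\bigcap_{i\in I}B_i\right)P\left(\bigcap_{i\notin I}B_i\right)}.$$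
   Context: For a non-singular $n\times n$ correlation matrix $R$ and $\alpha>0$, the $\Gamma_n(\alpha,R)$-distribution is the probability distribution on $(0,\infty)^n$ with Laplace transform $E\exp(-\sum_i t_iX_i)=|I_n+RT|^{-\alpha}$, $T=\mathrm{Diag}(t_1,\dots,t_n)$, $t_i\ge 0$ ($|\cdot|$ denotes the determinant), whenever such a distribution exists. For the matrix $R$ considered here it exists for all $\alpha>0$ and its cdf is $$F(x_1,\dots,x_n)=\int_0^\infty\Big(\prod_{j=1}^nG_\alpha\big(\tfrac{x_j}{1-a_j^2};\tfrac{a_j^2y}{1-a_j^2}\big)\Big)g_\alpha(y)\,dy,$$ where $g_\alpha(x)=x^{\alpha-1}e^{-x}/\Gamma(\alpha)$ for $x>0$, $G_\alpha$ is the cdf with density $g_\alpha$, and $G_\alpha(x;y)=e^{-y}\sum_{m=0}^\infty G_{\alpha+m}(x)\frac{y^m}{m!}$ is the non-central gamma cdf. An everywhere positive function $F$ on $(0,\infty)^n$ is MTP$_2$ if $F(\vec{x}\vee\vec{y})F(\vec{x}\wedge\vec{y})\ge F(\vec{x})F(\vec{y})$ for all $\vec{x},\vec{y}\in(0,\infty)^n$, where $\vee,\wedge$ are componentwise maximum and minimum. *)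

theory Defs
  imports "HOL-Probability.Probability"
begin

definition diag_mat :: "real ^ 'n \<Rightarrow> real ^ 'n ^ 'n" where
  "diag_mat v = (\<chi> i j. if i = j then v $ i else 0)"

definition outer_prod :: "real ^ 'n \<Rightarrow> real ^ 'n \<Rightarrow> real ^ 'n ^ 'n" where
  "outer_prod v w = (\<chi> i j. v $ i * w $ j)"

definition pos_orthant :: "(real ^ 'n) set" where
  "pos_orthant = {x. \<forall>i. 0 < x $ i}"

(* M is the Gamma_n(alpha,R)-distribution. Used for alpha > 0 and non-singular correlation
   matrices R; then det (I + R T) > 0 for t >= 0, so powr is the ordinary power. The Laplace
   integrand takes values in [0,1] almost everywhere, hence is integrable. *)
definition gamma_distribution :: "real \<Rightarrow> real ^ 'n ^ 'n \<Rightarrow> (real ^ 'n) measure \<Rightarrow> bool" where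
  "gamma_distribution \<alpha> R M \<longleftrightarrow>
     prob_space M \<and> sets M = sets borel \<and> measure M pos_orthant = 1 \<and>
     (\<forall>t. (\<forall>i. 0 \<le> t $ i) \<longrightarrow>
        (\<integral>x. exp (- (\<Sum>i\<in>UNIV. t $ i * x $ i)) \<partial>M) = det (mat 1 + R ** diag_mat t) powr (- \<alpha>))"

(* The order on real ^ 'n is componentwise, so {..x} is the lower orthant. *)
definition joint_cdf :: "(real ^ 'n) measure \<Rightarrow> real ^ 'n \<Rightarrow> real" where
  "joint_cdf M x = measure M {..x}"

(* sup and inf on real ^ 'n are the componentwise maximum and minimum. *)
definition MTP2 :: "(real ^ 'n \<Rightarrow> real) \<Rightarrow> bool" where
  "MTP2 F \<longleftrightarrow>
     (\<forall>x\<in>pos_orthant. 0 < F x) \<and>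
     (\<forall>x\<in>pos_orthant. \<forall>y\<in>pos_orthant. F x * F y \<le> F (sup x y) * F (inf x y))"

end

theory Submission
  imports Defs
begin

text \<open>
  The proof represents the distribution as a mixture over one hidden variable and reads total
  positivity off that mixture. Put \<open>c\<^sub>i = 1 - a\<^sub>i\<^sup>2\<close> and \<open>l\<^sub>i = a\<^sub>i\<^sup>2 / c\<^sub>i\<close>. Let \<open>Y\<close> have the standard gamma
  distribution with shape \<open>\<alpha>\<close>; given \<open>Y = y\<close> let the \<open>K\<^sub>i\<close> be independent Poisson variables with means
  \<open>l\<^sub>i y\<close>, and given these let the \<open>X\<^sub>i\<close> be independent gamma variables with shape \<open>\<alpha> + K\<^sub>i\<close> and scale
  \<open>c\<^sub>i\<close>. Conditionally on \<open>Y = y\<close> the Laplace transform factorises into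
  \<open>(1 + c\<^sub>i t\<^sub>i)\<^bsup>-\<alpha>\<^esup> exp (- a\<^sub>i\<^sup>2 t\<^sub>i y / (1 + c\<^sub>i t\<^sub>i))\<close>, and integrating over \<open>Y\<close> gives
  \<open>(\<Prod>i. 1 + c\<^sub>i t\<^sub>i)\<^bsup>-\<alpha>\<^esup> (1 + \<Sum>i. a\<^sub>i\<^sup>2 t\<^sub>i / (1 + c\<^sub>i t\<^sub>i))\<^bsup>-\<alpha>\<^esup>\<close>. By the matrix determinant lemma
  (\<open>det_one_plus_one_factor\<close>) this is the prescribed transform, so the mixture is a
  \<open>\<Gamma>\<^sub>n(\<alpha>, R)\<close>-distribution (\<open>gamma_distribution_gamma_mixture\<close>).

  The cdf of the mixture is \<open>F x = \<integral> g y (\<Prod>i. H\<^sub>i (x\<^sub>i) y) dy\<close>, where \<open>H\<^sub>i\<close> is a non-central gamma cdf.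
  Everything about positivity follows from one inequality, the four functions theorem on a
  linear order (\<open>nn_integral_four_functions\<close>). It shows that composing two \<open>TP\<^sub>2\<close> kernels yields a
  \<open>TP\<^sub>2\<close> kernel (\<open>TP2_compose\<close>). The kernels \<open>x\<^sup>m\<close> and \<open>1(u \<le> x)\<close> are \<open>TP\<^sub>2\<close>; the former governs both
  the gamma densities, as functions of the point and of the number \<open>m\<close> added to the shape, and the
  Poisson weights. Two compositions, over \<open>m\<close> and then over \<open>u\<close>, therefore make \<open>H\<^sub>i\<close> a \<open>TP\<^sub>2\<close> kernel in
  \<open>(x\<^sub>i, y)\<close>. The same inequality, now applied to the integral over \<open>y\<close>, turns this into log-supermodularity
  of \<open>F\<close> (\<open>marginal_log_supermodular\<close>).

  An arbitrary \<open>\<Gamma>\<^sub>n(\<alpha>, R)\<close>-distribution has the same cdf as the mixture because the Laplace transform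
  determines the cdf (\<open>joint_cdf_eq_of_laplace_eq\<close>): the substitution \<open>u\<^sub>i = exp (- x\<^sub>i)\<close> moves the
  distributions to the unit cube, where the Laplace transform at integer points is the family of all mixed
  moments, and polynomials are uniformly dense in the continuous functions.

  The inequality for the quotients holds for every random vector whose cdf is \<open>MTP\<^sub>2\<close>
  (\<open>orthant_ratio_le_of_MTP2\<close>): two applications of the defining inequality, with the coordinates
  outside \<open>I\<close>, respectively inside \<open>I\<close>, sent to infinity, multiply to the claim.
\<close>

section \<open>Total positivity and the four functions theorem\<close>

text \<open>
  For real numbers this is \<open>0 \<le> (C - A) (C - B)\<close>, which gives \<open>C (A + B) \<le> C\<^sup>2 + A B \<le> C (C + D)\<close>.
  Working in the extended nonnegative reals means that no integrability has to be tracked below.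
\<close>
lemma add_le_add_of_mult_le_mult_ennreal:
  fixes A B C D :: ennreal
  assumes "A \<le> C" "B \<le> C" "A * B \<le> C * D"
  shows "A + B \<le> C + D"
proof (cases "C = top \<or> D = top")
  case True
  then show ?thesis by auto
next
  case False
  with assms(1,2) have "A \<noteq> top" "B \<noteq> top"
    by (auto simp: top_unique)
  with False obtain a b c d where
    eq: "A = ennreal a" "B = ennreal b" "C = ennreal c" "D = ennreal d"
    and nn: "0 \<le> a" "0 \<le> b" "0 \<le> c" "0 \<le> d"
    by (metis ennreal_cases)
  have ac: "a \<le> c" and bc: "b \<le> c"
    using assms(1,2) nn by (simp_all add: eq)
  have "ennreal (a * b) \<le> ennreal (c * d)"
    using assms(3) nn by (simp add: eq ennreal_mult)
  then have abcd: "a * b \<le> c * d"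
    using nn by (simp add: ennreal_le_iff)
  have "a + b \<le> c + d"
  proof (cases "c = 0")
    case True
    with ac bc nn show ?thesis by simp
  next
    case False
    have "0 \<le> (c - a) * (c - b)"
      using ac bc by simp
    then have "c * (a + b) \<le> c * (c + d)"
      using abcd by (simp add: algebra_simps)
    with False nn show ?thesis by simp
  qed
  with nn show ?thesis
    by (simp add: eq flip: ennreal_plus)
qed

text \<open>
  The one-dimensional four functions theorem. Symmetrising the product of integrals pairs the value at
  \<open>(y, z)\<close> with the value at \<open>(z, y)\<close>, and the integrands can then be compared pointwise: for \<open>z \<le> y\<close> both
  terms on the left are bounded by \<open>f3 y * f4 z\<close>, and the product of the two is bounded through
  the diagonal cases \<open>(y, y)\<close> and \<open>(z, z)\<close> of the hypothesis. No product measure, hence no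
  sigma-finiteness, is involved, because the double integrals factorise.
\<close>
lemma nn_integral_four_functions:
  fixes f1 f2 f3 f4 :: "'a::linorder \<Rightarrow> ennreal"
  assumes [measurable]: "f1 \<in> borel_measurable \<mu>" "f2 \<in> borel_measurable \<mu>"
      "f3 \<in> borel_measurable \<mu>" "f4 \<in> borel_measurable \<mu>"
    and le: "\<And>y z. f1 y * f2 z \<le> f3 (max y z) * f4 (min y z)"
  shows "(\<integral>\<^sup>+y. f1 y \<partial>\<mu>) * (\<integral>\<^sup>+y. f2 y \<partial>\<mu>) \<le> (\<integral>\<^sup>+y. f3 y \<partial>\<mu>) * (\<integral>\<^sup>+y. f4 y \<partial>\<mu>)"
proof -
  have ordered: "f1 y * f2 z + f1 z * f2 y \<le> f3 y * f4 z + f3 z * f4 y" if "z \<le> y" for y z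
  proof (rule add_le_add_of_mult_le_mult_ennreal)
    show "f1 y * f2 z \<le> f3 y * f4 z"
      using le[of y z] that by (simp add: max_def min_def split: if_splits)
    show "f1 z * f2 y \<le> f3 y * f4 z"
      using le[of z y] that by (simp add: max_def min_def split: if_splits)
    have "(f1 y * f2 y) * (f1 z * f2 z) \<le> (f3 y * f4 y) * (f3 z * f4 z)"
      using le[of y y] le[of z z] by - (rule mult_mono, simp_all)
    then show "(f1 y * f2 z) * (f1 z * f2 y) \<le> (f3 y * f4 z) * (f3 z * f4 y)"
      by (simp add: mult_ac)
  qed
  have pointwise: "f1 y * f2 z + f1 z * f2 y \<le> f3 y * f4 z + f3 z * f4 y" for y z
    using ordered[of z y] ordered[of y z] by (cases "z \<le> y") (auto simp: add_ac)
  have double: "(\<integral>\<^sup>+y. \<integral>\<^sup>+z. f y * g z + f z * g y \<partial>\<mu> \<partial>\<mu>)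
      = 2 * ((\<integral>\<^sup>+y. f y \<partial>\<mu>) * (\<integral>\<^sup>+y. g y \<partial>\<mu>))"
    if [measurable]: "f \<in> borel_measurable \<mu>" "g \<in> borel_measurable \<mu>" for f g :: "'a \<Rightarrow> ennreal"
    by (simp add: nn_integral_add nn_integral_cmult nn_integral_multc mult_2)
  have "2 * ((\<integral>\<^sup>+y. f1 y \<partial>\<mu>) * (\<integral>\<^sup>+y. f2 y \<partial>\<mu>)) \<le> 2 * ((\<integral>\<^sup>+y. f3 y \<partial>\<mu>) * (\<integral>\<^sup>+y. f4 y \<partial>\<mu>))"
    by (subst (1 2) double[symmetric]) (auto intro!: nn_integral_mono pointwise)
  then show ?thesis
    by (simp add: ennreal_mult_le_mult_iff)
qed

definition TP2 :: "('a::linorder \<Rightarrow> 'b::linorder \<Rightarrow> ennreal) \<Rightarrow> bool" where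
  "TP2 K \<longleftrightarrow> (\<forall>x x' y y'. K x y * K x' y' \<le> K (max x x') (max y y') * K (min x x') (min y y'))"

lemma TP2_swap: "TP2 K \<Longrightarrow> TP2 (\<lambda>y x. K x y)"
  by (auto simp: TP2_def)

text \<open>
  The basic composition formula. The measure is arbitrary, so that sums over \<open>nat\<close> and integrals over the
  reals are covered alike.
\<close>
lemma TP2_compose:
  assumes K: "TP2 K" and L: "TP2 L"
    and [measurable]: "\<And>x. (\<lambda>y. K x y) \<in> borel_measurable \<mu>" "\<And>z. (\<lambda>y. L y z) \<in> borel_measurable \<mu>"
  shows "TP2 (\<lambda>x z. \<integral>\<^sup>+y. K x y * L y z \<partial>\<mu>)"
  unfolding TP2_def
proof (intro allI, rule nn_integral_four_functions)
  fix x x' z z' y y'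
  have "(K x y * K x' y') * (L y z * L y' z')
      \<le> (K (max x x') (max y y') * K (min x x') (min y y')) *
        (L (max y y') (max z z') * L (min y y') (min z z'))"
    using K L unfolding TP2_def by - (rule mult_mono, simp_all)
  then show "(K x y * L y z) * (K x' y' * L y' z')
      \<le> (K (max x x') (max y y') * L (max y y') (max z z')) *
        (K (min x x') (min y y') * L (min y y') (min z z'))"
    by (simp add: mult_ac)
qed measurable

text \<open>
  The source of all total positivity here: for \<open>0 < x \<le> x'\<close> and \<open>m' \<le> m\<close> one has
  \<open>x\<^bsup>m - m'\<^esup> \<le> x'\<^bsup>m - m'\<^esup>\<close>, and factors that depend on one argument only cancel from the inequality.
\<close>
lemma TP2_power:
  fixes K :: "real \<Rightarrow> nat \<Rightarrow> ennreal" and p :: "nat \<Rightarrow> real" and q :: "real \<Rightarrow> real"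
  assumes pos: "\<And>x m. 0 < x \<Longrightarrow> K x m = ennreal (p m * q x * x ^ m)"
    and neg: "\<And>x m. x \<le> 0 \<Longrightarrow> K x m = 0"
    and p: "\<And>m. 0 \<le> p m" and q: "\<And>x. 0 < x \<Longrightarrow> 0 \<le> q x"
  shows "TP2 K"
proof -
  have cross: "K x m * K x' m' \<le> K x' m * K x m'" if "x \<le> x'" "m' \<le> m" for x x' m m'
  proof (cases "0 < x")
    case False
    then show ?thesis by (simp add: neg)
  next
    case True
    with that have x': "0 < x'" by simp
    have "x ^ (m - m') \<le> x' ^ (m - m')"
      using True that by (intro power_mono) auto
    then have "x ^ (m - m') * (x ^ m' * x' ^ m') \<le> x' ^ (m - m') * (x ^ m' * x' ^ m')"
      using True x' by (intro mult_right_mono) auto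
    moreover have "z ^ m = z ^ (m - m') * z ^ m'" for z :: real
      using that by (simp flip: power_add)
    ultimately have "x ^ m * x' ^ m' \<le> x' ^ m * x ^ m'"
      by (simp add: mult_ac)
    then have "(p m * p m' * q x * q x') * (x ^ m * x' ^ m') \<le> (p m * p m' * q x * q x') * (x' ^ m * x ^ m')"
      using p q True x' by (intro mult_left_mono) auto
    then have "(p m * q x * x ^ m) * (p m' * q x' * x' ^ m') \<le> (p m * q x' * x' ^ m) * (p m' * q x * x ^ m')"
      by (simp add: mult_ac)
    then show ?thesis
      using True x' p q by (simp add: pos ennreal_leI flip: ennreal_mult)
  qed
  show ?thesis
    unfolding TP2_def
  proof (intro allI)
    fix x x' m m'
    show "K x m * K x' m' \<le> K (max x x') (max m m') * K (min x x') (min m m')"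
      using cross[of x x' m' m] cross[of x' x m m'] cross[of x x' m m'] cross[of x' x m' m]
      by (cases x x' rule: linorder_le_cases; cases m m' rule: linorder_le_cases)
         (simp_all add: max_def min_def mult_ac split: if_splits)
  qed
qed

lemma TP2_indicator_atMost: "TP2 (\<lambda>(x::'a::linorder) u. indicator {..x} u)"
  by (auto simp: TP2_def indicator_def max_def min_def)

lemma prod_mono_ennreal:
  fixes f g :: "'i \<Rightarrow> ennreal"
  assumes "\<And>i. i \<in> A \<Longrightarrow> f i \<le> g i"
  shows "prod f A \<le> prod g A"
  using assms by (induction A rule: infinite_finite_induct) (auto intro: mult_mono)

text \<open>
  A product of \<open>TP\<^sub>2\<close> kernels that share the variable \<open>y\<close> is log-supermodular in \<open>(x, y)\<close> jointly, and
  integrating \<open>y\<close> out preserves this by the four functions theorem. The weight \<open>g\<close> is harmless since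
  \<open>y\<close> ranges over a linear order.
\<close>
lemma marginal_log_supermodular:
  fixes H :: "'n::finite \<Rightarrow> real \<Rightarrow> real \<Rightarrow> ennreal" and g :: "real \<Rightarrow> ennreal" and x x' :: "real ^ 'n"
  assumes H: "\<And>i. TP2 (H i)"
    and [measurable]: "g \<in> borel_measurable \<mu>" "\<And>i r. H i r \<in> borel_measurable \<mu>"
  defines "F \<equiv> \<lambda>x. \<integral>\<^sup>+y. g y * (\<Prod>i\<in>UNIV. H i (x $ i) y) \<partial>\<mu>"
  shows "F x * F x' \<le> F (sup x x') * F (inf x x')"
  unfolding F_def
proof (rule nn_integral_four_functions)
  fix y y'
  have g: "g y * g y' = g (max y y') * g (min y y')"
    by (auto simp: max_def min_def mult_ac)
  have "(\<Prod>i\<in>UNIV. H i (x $ i) y) * (\<Prod>i\<in>UNIV. H i (x' $ i) y')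
      = (\<Prod>i\<in>UNIV. H i (x $ i) y * H i (x' $ i) y')"
    by (simp add: prod.distrib)
  also have "\<dots> \<le> (\<Prod>i\<in>UNIV. H i (sup x x' $ i) (max y y') * H i (inf x x' $ i) (min y y'))"
    using H by (intro prod_mono_ennreal) (auto simp: TP2_def sup_vec_def inf_vec_def sup_max inf_min)
  also have "\<dots> = (\<Prod>i\<in>UNIV. H i (sup x x' $ i) (max y y')) * (\<Prod>i\<in>UNIV. H i (inf x x' $ i) (min y y'))"
    by (simp add: prod.distrib)
  finally have "(g y * g y') * ((\<Prod>i\<in>UNIV. H i (x $ i) y) * (\<Prod>i\<in>UNIV. H i (x' $ i) y'))
     \<le> (g (max y y') * g (min y y')) *
       ((\<Prod>i\<in>UNIV. H i (sup x x' $ i) (max y y')) * (\<Prod>i\<in>UNIV. H i (inf x x' $ i) (min y y')))"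
    unfolding g by (intro mult_left_mono) auto
  then show "(g y * (\<Prod>i\<in>UNIV. H i (x $ i) y)) * (g y' * (\<Prod>i\<in>UNIV. H i (x' $ i) y'))
     \<le> (g (max y y') * (\<Prod>i\<in>UNIV. H i (sup x x' $ i) (max y y'))) *
       (g (min y y') * (\<Prod>i\<in>UNIV. H i (inf x x' $ i) (min y y')))"
    by (simp add: mult_ac)
qed measurable

section \<open>Orthant probabilities under the MTP2 property\<close>

text \<open>
  Write \<open>F(u, v)\<close> for the cdf with the coordinates in \<open>I\<close> and outside \<open>I\<close> separated, and \<open>N\<close> for a large
  bound. The \<open>MTP\<^sub>2\<close> inequality gives \<open>F(x, N) F(b, x) \<le> F(b, N) F(x, x)\<close> and
  \<open>F(N, x) F(b, b) \<le> F(N, b) F(b, x)\<close>. In the product of the two \<open>F(b, x)\<close> cancels, and letting \<open>N\<close> tend to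
  infinity replaces the factors involving \<open>N\<close> by marginal probabilities.
\<close>
lemma orthant_ratio_le_of_MTP2:
  fixes \<Omega> :: "'w measure" and X :: "'w \<Rightarrow> real ^ 'n" and x b :: "real ^ 'n" and I :: "'n set"
  assumes "prob_space \<Omega>" and X[measurable]: "X \<in> borel_measurable \<Omega>"
    and mtp: "MTP2 (joint_cdf (distr \<Omega> borel X))"
    and xb: "\<And>i. 0 < x $ i \<and> x $ i \<le> b $ i"
  defines "E \<equiv> \<lambda>z J. measure \<Omega> (\<Inter>i\<in>J. {\<omega> \<in> space \<Omega>. X \<omega> $ i \<le> z $ i})"
  assumes I: "I \<noteq> {}" "I \<noteq> UNIV"
  shows "E b UNIV / (E b I * E b (- I)) \<le> E x UNIV / (E x I * E x (- I))"
proof -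
  interpret prob_space \<Omega> by fact
  let ?F = "joint_cdf (distr \<Omega> borel X)"
  have F_pos: "0 < ?F z" if "\<And>i. 0 < z $ i" for z
    using mtp that by (simp add: MTP2_def pos_orthant_def)
  have F_mtp: "?F z * ?F w \<le> ?F (sup z w) * ?F (inf z w)" if "\<And>i. 0 < z $ i" "\<And>i. 0 < w $ i" for z w
    using mtp that by (simp add: MTP2_def pos_orthant_def)
  have F: "?F z = E z UNIV" for z
    unfolding joint_cdf_def E_def
    by (subst measure_distr) (auto intro!: arg_cong[where f = "measure \<Omega>"] simp: less_eq_vec_def)
  have x: "0 < x $ i" and b: "0 < b $ i" and le: "x $ i \<le> b $ i" for i
    using xb[of i] by auto
  have E_sets: "(\<Inter>i\<in>J. {\<omega> \<in> space \<Omega>. X \<omega> $ i \<le> z $ i}) \<in> sets \<Omega>" if "J \<noteq> {}" for J z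
    using that by measurable
  \<comment> \<open>The bounds outside \<open>J\<close> start at \<open>b\<close>, so that \<open>ext z J k\<close> dominates both \<open>x\<close> and \<open>b\<close> there.\<close>
  define ext where "ext = (\<lambda>(z::real ^ 'n) J k. (\<chi> i. if i \<in> J then z $ i else b $ i + real k))"
  have ext_pos: "0 < ext z J k $ i" if "\<And>i. 0 < z $ i" for z J k i
    using that[of i] b[of i] by (simp add: ext_def)
  have ext_lim: "(\<lambda>k. ?F (ext z J k)) \<longlonglongrightarrow> E z J" if "J \<noteq> {}" for z J
  proof -
    let ?A = "\<lambda>k. \<Inter>i. {\<omega> \<in> space \<Omega>. X \<omega> $ i \<le> ext z J k $ i}"
    have "(\<lambda>k. measure \<Omega> (?A k)) \<longlonglongrightarrow> measure \<Omega> (\<Union>k. ?A k)"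
      by (intro Lim_measure_incseq)
         (auto simp: ext_def incseq_def le_fun_def intro!: E_sets; force split: if_splits)+
    moreover have "(\<Union>k. ?A k) = (\<Inter>i\<in>J. {\<omega> \<in> space \<Omega>. X \<omega> $ i \<le> z $ i})"
    proof (intro equalityI subsetI)
      fix \<omega> assume "\<omega> \<in> (\<Union>k. ?A k)"
      then show "\<omega> \<in> (\<Inter>i\<in>J. {\<omega> \<in> space \<Omega>. X \<omega> $ i \<le> z $ i})"
        by (force simp: ext_def split: if_splits)
    next
      fix \<omega> assume \<omega>: "\<omega> \<in> (\<Inter>i\<in>J. {\<omega> \<in> space \<Omega>. X \<omega> $ i \<le> z $ i})"
      obtain k :: nat where k: "Max (range (\<lambda>i. X \<omega> $ i - b $ i)) < real k"
        using reals_Archimedean2 by blast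
      have "X \<omega> $ i - b $ i < real k" for i
        using k by (subst (asm) Max_less_iff) auto
      with \<omega> that have "\<omega> \<in> ?A k"
        by (auto simp: ext_def algebra_simps less_imp_le)
      then show "\<omega> \<in> (\<Union>k. ?A k)" by blast
    qed
    ultimately show ?thesis unfolding F E_def by simp
  qed
  have mono: "?F z \<le> E z J" if "J \<noteq> {}" for z J
    unfolding F E_def using E_sets that by (intro finite_measure_mono) auto
  have E_pos: "0 < E z J" if "\<And>i. 0 < z $ i" "J \<noteq> {}" for z J
    using F_pos[of z] mono[of J z] that by force
  \<comment> \<open>The corner \<open>(b, x)\<close> at which the cdf cancels.\<close>
  define bx where "bx = (\<chi> i. if i \<in> I then b $ i else x $ i)"
  have bx: "0 < bx $ i" for i using x b by (simp add: bx_def)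
  have step: "?F (ext x I k) * ?F (ext x (- I) k) * ?F b \<le> ?F (ext b I k) * ?F (ext b (- I) k) * ?F x" for k
  proof -
    have "?F (ext x I k) * ?F bx \<le> ?F (sup (ext x I k) bx) * ?F (inf (ext x I k) bx)"
      using ext_pos x bx by (intro F_mtp) auto
    also have "sup (ext x I k) bx = ext b I k"
      using le by (auto simp: vec_eq_iff sup_vec_def ext_def bx_def sup_max max_def intro: antisym)
        (smt (verit) of_nat_0_le_iff le)
    also have "inf (ext x I k) bx = x"
      using le by (auto simp: vec_eq_iff inf_vec_def ext_def bx_def inf_min min_def intro: antisym)
        (smt (verit) of_nat_0_le_iff le)
    finally have 1: "?F (ext x I k) * ?F bx \<le> ?F (ext b I k) * ?F x" .
    have "?F (ext x (- I) k) * ?F b \<le> ?F (sup (ext x (- I) k) b) * ?F (inf (ext x (- I) k) b)"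
      using ext_pos x b by (intro F_mtp) auto
    also have "sup (ext x (- I) k) b = ext b (- I) k"
      using le by (auto simp: vec_eq_iff sup_vec_def ext_def sup_max max_def intro: antisym)
    also have "inf (ext x (- I) k) b = bx"
      using le by (auto simp: vec_eq_iff inf_vec_def ext_def bx_def inf_min min_def intro: antisym)
    finally have 2: "?F (ext x (- I) k) * ?F b \<le> ?F (ext b (- I) k) * ?F bx" .
    have "(?F (ext x I k) * ?F bx) * (?F (ext x (- I) k) * ?F b)
        \<le> (?F (ext b I k) * ?F x) * (?F (ext b (- I) k) * ?F bx)"
      by (rule mult_mono[OF 1 2]) (simp_all add: joint_cdf_def)
    then have "?F bx * (?F (ext x I k) * ?F (ext x (- I) k) * ?F b)
        \<le> ?F bx * (?F (ext b I k) * ?F (ext b (- I) k) * ?F x)"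
      by (simp add: mult_ac)
    then show ?thesis
      using F_pos[of bx] bx by (simp add: mult_le_cancel_left_pos)
  qed
  have "E x I * E x (- I) * ?F b \<le> E b I * E b (- I) * ?F x"
  proof (rule LIMSEQ_le)
    have ne: "I \<noteq> {}" "- I \<noteq> {}" using I by auto
    show "(\<lambda>k. ?F (ext x I k) * ?F (ext x (- I) k) * ?F b) \<longlonglongrightarrow> E x I * E x (- I) * ?F b"
      by (intro tendsto_mult ext_lim tendsto_const ne)
    show "(\<lambda>k. ?F (ext b I k) * ?F (ext b (- I) k) * ?F x) \<longlonglongrightarrow> E b I * E b (- I) * ?F x"
      by (intro tendsto_mult ext_lim tendsto_const ne)
  qed (use step in auto)
  moreover have "0 < E z I * E z (- I)" if "\<And>i. 0 < z $ i" for z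
  proof -
    have "- I \<noteq> {}" using I by auto
    with E_pos[OF that] I show ?thesis by (metis mult_pos_pos)
  qed
  note this[OF x] this[OF b]
  ultimately show ?thesis
    by (simp add: F divide_le_eq pos_le_divide_eq mult_ac)
qed

section \<open>Determinant of a diagonal matrix plus a rank-one matrix\<close>

text \<open>
  Subtracting multiples of row \<open>k\<close>, which is \<open>v\<close>, removes the rank-one perturbation from all other rows.
\<close>
lemma det_mat_1_with_row:
  fixes u v :: "real ^ 'n"
  assumes "finite S" "k \<notin> S"
  shows "det (\<chi> i. if i = k then v else if i \<in> S then axis i 1 + u $ i *s v else axis i 1) = v $ k"
  using assms
proof (induction S)
  case empty
  have "det (\<chi> i. if i = k then sum (\<lambda>i. v $ i *s row i (mat 1)) (UNIV::'n set) else row i (mat 1)) = v $ k"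
    by (subst cramer_lemma_transpose) simp
  moreover have "row i (mat 1 :: real ^ 'n ^ 'n) = axis i 1" for i :: 'n
    by (simp add: vec_eq_iff row_def mat_def axis_def)
  moreover have "sum (\<lambda>i. v $ i *s axis i 1) (UNIV::'n set) = v"
    by (simp add: basis_expansion)
  ultimately show ?case by (simp cong: if_cong)
next
  case (insert j S)
  let ?A = "\<chi> i. if i = k then v else if i \<in> S then axis i 1 + u $ i *s v else axis i 1"
  have "det (\<chi> i. if i = j then row j ?A + u $ j *s row k ?A else row i ?A) = det ?A"
    using insert by (intro det_row_operation) auto
  moreover have "(\<chi> i. if i = j then row j ?A + u $ j *s row k ?A else row i ?A) =
      (\<chi> i. if i = k then v else if i \<in> insert j S then axis i 1 + u $ i *s v else axis i 1)"
    using insert by (auto simp: vec_eq_iff row_def)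
  ultimately show ?case using insert by simp
qed

text \<open>
  The perturbation is switched on row by row. By linearity in row \<open>k\<close>, each new row adds the determinant
  in which that row is \<open>u $ k *s v\<close>, which \<open>det_mat_1_with_row\<close> evaluates.
\<close>
lemma det_rank_one_update_mat_1:
  fixes u v :: "real ^ 'n"
  shows "det (mat 1 + outer_prod u v) = 1 + (\<Sum>i\<in>UNIV. u $ i * v $ i)"
proof -
  have "det (\<chi> i. if i \<in> S then axis i 1 + u $ i *s v else axis i 1) = 1 + (\<Sum>i\<in>S. u $ i * v $ i)"
    if "finite S" for S
    using that
  proof (induction S)
    case empty
    have "(\<chi> i. axis i 1) = (mat 1 :: real ^ 'n ^ 'n)"
      by (simp add: vec_eq_iff mat_def axis_def)
    then show ?case by simp
  next
    case (insert k S)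
    let ?c = "\<lambda>i. if i \<in> S then axis i 1 + u $ i *s v else axis i 1"
    have split: "(\<chi> i. if i \<in> insert k S then axis i 1 + u $ i *s v else axis i 1)
        = (\<chi> i. if i = k then axis i 1 + u $ i *s v else ?c i)"
      by (auto simp: vec_eq_iff)
    have unchanged: "(\<chi> i. if i = k then axis i 1 else ?c i) = (\<chi> i. ?c i)"
      using insert by (auto simp: vec_eq_iff)
    have scaled: "det (\<chi> i. if i = k then u $ i *s v else ?c i) = u $ k * v $ k"
    proof -
      have "(\<chi> i. if i = k then u $ i *s v else ?c i) = (\<chi> i. if i = k then u $ k *s v else ?c i)"
        by (auto simp: vec_eq_iff)
      then show ?thesis
        using insert by (simp add: det_row_mul det_mat_1_with_row)
    qed
    show ?case
      unfolding split det_row_add unchanged scaled using insert by simp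
  qed
  from this[of UNIV] show ?thesis
    by (simp add: outer_prod_def mat_def axis_def vec_eq_iff plus_vec_def vector_scalar_mult_def
        cong: if_cong) (smt (verit) Cart_lambda_cong)
qed

text \<open>
  Pulling the diagonal matrix with entries \<open>1 + c\<^sub>i t\<^sub>i\<close> out on the left leaves a rank-one perturbation of the
  identity.
\<close>
lemma det_one_plus_one_factor:
  fixes a t :: "real ^ 'n" and c :: "real ^ 'n"
  assumes "\<And>i. 0 < 1 + c $ i * t $ i"
  shows "det (mat 1 + (diag_mat c + outer_prod a a) ** diag_mat t)
    = (\<Prod>i\<in>UNIV. 1 + c $ i * t $ i) * (1 + (\<Sum>i\<in>UNIV. (a $ i)\<^sup>2 * t $ i / (1 + c $ i * t $ i)))"
proof -
  define d where "d = (\<chi> i. 1 + c $ i * t $ i)"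
  define u where "u = (\<chi> i. a $ i / d $ i)"
  define v where "v = (\<chi> i. a $ i * t $ i)"
  have d: "d $ i \<noteq> 0" for i using assms[of i] by (simp add: d_def)
  have left: "(diag_mat d ** B) $ i $ j = d $ i * B $ i $ j" for B :: "real ^ 'n ^ 'n" and i j
    by (simp add: matrix_matrix_mult_def diag_mat_def if_distrib if_distribR sum.delta cong: if_cong)
  have right: "(B ** diag_mat t) $ i $ j = B $ i $ j * t $ j" for B :: "real ^ 'n ^ 'n" and i j
    by (simp add: matrix_matrix_mult_def diag_mat_def if_distrib sum.delta cong: if_cong)
  have "mat 1 + (diag_mat c + outer_prod a a) ** diag_mat t = diag_mat d ** (mat 1 + outer_prod u v)"
    unfolding vec_eq_iff
  proof (intro allI)
    fix i j
    show "(mat 1 + (diag_mat c + outer_prod a a) ** diag_mat t) $ i $ j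
        = (diag_mat d ** (mat 1 + outer_prod u v)) $ i $ j"
      using d[of i] unfolding left vector_add_component right
      by (auto simp: diag_mat_def outer_prod_def u_def v_def mat_def distrib_left)
         (simp add: d_def distrib_right)
  qed
  then have "det (mat 1 + (diag_mat c + outer_prod a a) ** diag_mat t)
      = det (diag_mat d) * (1 + (\<Sum>i\<in>UNIV. u $ i * v $ i))"
    by (simp add: det_mul det_rank_one_update_mat_1)
  also have "det (diag_mat d) = (\<Prod>i\<in>UNIV. d $ i)"
    by (subst det_diagonal) (auto simp: diag_mat_def)
  finally show ?thesis
    by (simp add: d_def u_def v_def power2_eq_square mult_ac)
qed

section \<open>Uniqueness of the Laplace transform on the positive orthant\<close>

text \<open>
  The polynomial functions, built as sums of monomials rather than from sums and products: on a
  monomial the integral is a value of the Laplace transform, and the rule \<open>sum\<close> is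
  compatible with integration.
\<close>
inductive_set monomial_sums :: "(real ^ 'n \<Rightarrow> real) set" where
  monomial: "(\<lambda>u. c * (\<Prod>i\<in>UNIV. u $ i ^ k i)) \<in> monomial_sums"
| sum: "f \<in> monomial_sums \<Longrightarrow> g \<in> monomial_sums \<Longrightarrow> (\<lambda>u. f u + g u) \<in> monomial_sums"

lemma monomial_sums_mult:
  fixes f g :: "real ^ 'n \<Rightarrow> real"
  assumes "f \<in> monomial_sums" "g \<in> monomial_sums"
  shows "(\<lambda>u. f u * g u) \<in> monomial_sums"
  using assms
proof (induction f)
  case (monomial c k)
  from monomial.prems show ?case
  proof (induction g)
    case (monomial c' k')
    have "(\<lambda>u. c * (\<Prod>i\<in>UNIV. u $ i ^ k i) * (c' * (\<Prod>i\<in>UNIV. u $ i ^ k' i)))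
        = (\<lambda>u :: real ^ 'n. (c * c') * (\<Prod>i\<in>UNIV. u $ i ^ (k i + k' i)))"
      by (simp add: power_add prod.distrib mult_ac)
    then show ?case
      using monomial_sums.monomial[of "c * c'" "\<lambda>i. k i + k' i"] by simp
  next
    case (sum f g)
    then show ?case by (simp add: distrib_left monomial_sums.sum)
  qed
next
  case (sum f g)
  then show ?case by (simp add: distrib_right monomial_sums.sum)
qed

lemma monomial_sums_continuous_on: "f \<in> monomial_sums \<Longrightarrow> continuous_on S f"
proof (induction rule: monomial_sums.induct)
  case (monomial c k)
  show ?case
    by (intro continuous_on_mult continuous_on_const continuous_on_prod continuous_on_power
        continuous_on_component continuous_on_id)
next
  case (sum f g)
  show ?case by (intro Limits.continuous_on_add sum.IH)
qed

lemma function_ring_on_monomial_sums: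
  fixes S :: "(real ^ 'n) set"
  assumes "compact S"
  shows "function_ring_on monomial_sums S"
proof
  show "(\<lambda>_. c) \<in> monomial_sums" for c :: real
    using monomial_sums.monomial[of c "\<lambda>_. 0"] by simp
  fix x y :: "real ^ 'n" assume "x \<noteq> y"
  then obtain i where "x $ i \<noteq> y $ i" by (auto simp: vec_eq_iff)
  moreover have "(\<lambda>u. u $ i) \<in> monomial_sums"
  proof -
    have "(\<Prod>j\<in>UNIV. u $ j ^ (if j = i then 1 else 0)) = u $ i" for u :: "real ^ 'n"
    proof -
      have "(\<Prod>j\<in>UNIV. u $ j ^ (if j = i then 1 else 0)) = (\<Prod>j\<in>UNIV. if j = i then u $ j else 1)"
        by (intro prod.cong) auto
      then show ?thesis by simp
    qed
    then show ?thesis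
      using monomial_sums.monomial[of 1 "\<lambda>j. if j = i then 1 else 0"]
      by (simp only: mult_1)
  qed
  ultimately show "\<exists>f\<in>monomial_sums. f x \<noteq> f y" by (rule bexI[where x = "\<lambda>u. u $ i"])
next
  fix f g :: "real ^ 'n \<Rightarrow> real" assume fg: "f \<in> monomial_sums" "g \<in> monomial_sums"
  show "(\<lambda>x. f x + g x) \<in> monomial_sums" by (rule monomial_sums.sum[OF fg])
  show "(\<lambda>x. f x * g x) \<in> monomial_sums" by (rule monomial_sums_mult[OF fg])
  show "continuous_on S f" by (rule monomial_sums_continuous_on[OF fg(1)])
qed (rule assms)

definition exp_neg :: "real ^ 'n \<Rightarrow> real ^ 'n" where
  "exp_neg x = (\<chi> i. exp (- x $ i))"

lemma continuous_on_exp_neg: "continuous_on S exp_neg"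
  unfolding exp_neg_def by (intro continuous_intros)

lemma borel_measurable_exp_neg [measurable]: "exp_neg \<in> borel_measurable borel"
  by (intro borel_measurable_continuous_onI continuous_on_exp_neg)

lemma AE_exp_neg_in_unit_cube:
  fixes M :: "(real ^ 'n) measure"
  assumes "prob_space M" "sets M = sets borel" "measure M pos_orthant = 1"
  shows "AE x in M. exp_neg x \<in> cbox 0 1"
proof -
  interpret prob_space M by fact
  have "(pos_orthant :: (real ^ 'n) set) \<in> sets borel"
    unfolding pos_orthant_def by measurable
  then have "AE x in M. x \<in> pos_orthant"
    using assms by (intro AE_prob_1) 
  then show ?thesis
    by eventually_elim (auto simp: pos_orthant_def exp_neg_def mem_box_cart intro: less_imp_le)
qed

text \<open>
  Almost every point is sent into the compact cube, on which a continuous function is bounded.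
\<close>
lemma integrable_continuous_exp_neg:
  fixes M :: "(real ^ 'n) measure" and f :: "real ^ 'n \<Rightarrow> real"
  assumes M: "prob_space M" "sets M = sets borel" "measure M pos_orthant = 1"
    and f: "continuous_on UNIV f"
  shows "integrable M (\<lambda>x. f (exp_neg x))"
proof -
  interpret prob_space M by fact
  note [measurable_cong] = M(2)
  have [measurable]: "f \<in> borel_measurable borel"
    using f by (rule borel_measurable_continuous_onI)
  have "compact (f ` cbox 0 1)"
    using f by (intro compact_continuous_image continuous_on_subset[OF f]) auto
  then obtain B where B: "\<And>u. u \<in> cbox 0 1 \<Longrightarrow> norm (f u) \<le> B"
    using compact_imp_bounded bounded_iff by (metis imageI)
  show ?thesis
    using AE_exp_neg_in_unit_cube[OF M]
    by (intro integrable_const_bound[where B = B]) (auto elim!: eventually_mono dest!: B)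
qed

text \<open>
  Under \<open>u\<^sub>i = exp (- x\<^sub>i)\<close> the monomial with exponents \<open>k\<close> is the Laplace kernel at the integer point \<open>k\<close>.
\<close>
lemma integral_monomial_sums_eq:
  fixes M N :: "(real ^ 'n) measure"
  assumes M: "prob_space M" "sets M = sets borel" "measure M pos_orthant = 1"
    and N: "prob_space N" "sets N = sets borel" "measure N pos_orthant = 1"
    and laplace: "\<And>t. (\<And>i. 0 \<le> t $ i) \<Longrightarrow>
        (\<integral>x. exp (- (\<Sum>i\<in>UNIV. t $ i * x $ i)) \<partial>M) = (\<integral>x. exp (- (\<Sum>i\<in>UNIV. t $ i * x $ i)) \<partial>N)"
    and p: "p \<in> monomial_sums"
  shows "(\<integral>x. p (exp_neg x) \<partial>M) = (\<integral>x. p (exp_neg x) \<partial>N)"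
  using p
proof (induction p)
  case (monomial c k)
  have "(\<Prod>i\<in>UNIV. exp_neg x $ i ^ k i) = exp (- (\<Sum>i\<in>UNIV. (\<chi> i. real (k i)) $ i * x $ i))" for x
  proof -
    have "exp (- (\<Sum>i\<in>UNIV. (\<chi> i. real (k i)) $ i * x $ i)) = (\<Prod>i\<in>UNIV. exp (real (k i) * - x $ i))"
      by (subst exp_sum[symmetric]) (simp, simp only: vec_lambda_beta mult_minus_right sum_negf)
    also have "\<dots> = (\<Prod>i\<in>UNIV. exp_neg x $ i ^ k i)"
      by (simp only: exp_of_nat_mult exp_neg_def vec_lambda_beta)
    finally show ?thesis by (rule sym)
  qed
  then show ?case
    using laplace[of "\<chi> i. real (k i)"] by simp
next
  case (sum f g)
  have int: "integrable L (\<lambda>x. q (exp_neg x))"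
    if L: "prob_space L" "sets L = sets borel" "measure L pos_orthant = 1" and q: "q \<in> monomial_sums"
    for L :: "(real ^ 'n) measure" and q
    by (rule integrable_continuous_exp_neg[OF L monomial_sums_continuous_on[OF q]])
  show ?case
    unfolding Bochner_Integration.integral_add[OF int[OF M sum.hyps(1)] int[OF M sum.hyps(2)]]
      Bochner_Integration.integral_add[OF int[OF N sum.hyps(1)] int[OF N sum.hyps(2)]] sum.IH ..
qed

lemma integral_continuous_exp_neg_eq:
  fixes M N :: "(real ^ 'n) measure"
  assumes M: "prob_space M" "sets M = sets borel" "measure M pos_orthant = 1"
    and N: "prob_space N" "sets N = sets borel" "measure N pos_orthant = 1"
    and laplace: "\<And>t. (\<And>i. 0 \<le> t $ i) \<Longrightarrow>
        (\<integral>x. exp (- (\<Sum>i\<in>UNIV. t $ i * x $ i)) \<partial>M) = (\<integral>x. exp (- (\<Sum>i\<in>UNIV. t $ i * x $ i)) \<partial>N)"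
    and f: "continuous_on UNIV (f :: real ^ 'n \<Rightarrow> real)"
  shows "(\<integral>x. f (exp_neg x) \<partial>M) = (\<integral>x. f (exp_neg x) \<partial>N)"
proof -
  interpret ring: function_ring_on monomial_sums "cbox 0 1 :: (real ^ 'n) set"
    by (intro function_ring_on_monomial_sums compact_cbox)
  have close: "\<bar>(\<integral>x. f (exp_neg x) \<partial>L) - (\<integral>x. p (exp_neg x) \<partial>L)\<bar> \<le> e"
    if L: "prob_space L" "sets L = sets borel" "measure L pos_orthant = 1"
      and p: "p \<in> monomial_sums" "\<And>u. u \<in> cbox 0 1 \<Longrightarrow> \<bar>f u - p u\<bar> < e"
    for L :: "(real ^ 'n) measure" and p e
  proof -
    interpret L: prob_space L by fact
    have int: "integrable L (\<lambda>x. f (exp_neg x))" "integrable L (\<lambda>x. p (exp_neg x))"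
      using integrable_continuous_exp_neg[OF L] f p monomial_sums_continuous_on by blast+
    have "\<bar>(\<integral>x. f (exp_neg x) \<partial>L) - (\<integral>x. p (exp_neg x) \<partial>L)\<bar> = \<bar>\<integral>x. f (exp_neg x) - p (exp_neg x) \<partial>L\<bar>"
      using int by simp
    also have "\<dots> \<le> (\<integral>x. \<bar>f (exp_neg x) - p (exp_neg x)\<bar> \<partial>L)"
      by (rule integral_abs_bound)
    also have "\<dots> \<le> (\<integral>x. e \<partial>L)"
      using int AE_exp_neg_in_unit_cube[OF L]
      by (intro integral_mono_AE) (auto elim!: eventually_mono dest!: p(2))
    also have "\<dots> = e" by (simp add: L.prob_space)
    finally show ?thesis .
  qed
  have "\<bar>(\<integral>x. f (exp_neg x) \<partial>M) - (\<integral>x. f (exp_neg x) \<partial>N)\<bar> \<le> 0 + e" if e: "0 < e" for e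
  proof -
    obtain p where p: "p \<in> monomial_sums" "\<And>u. u \<in> cbox 0 1 \<Longrightarrow> \<bar>f u - p u\<bar> < e / 2"
      using ring.Stone_Weierstrass_basic[of f "e / 2"] continuous_on_subset[OF f] e
      by (metis half_gt_zero subset_UNIV)
    have "(\<integral>x. p (exp_neg x) \<partial>M) = (\<integral>x. p (exp_neg x) \<partial>N)"
      by (rule integral_monomial_sums_eq[OF M N laplace p(1)])
    with close[OF M p] close[OF N p] show ?thesis by linarith
  qed
  then have "\<bar>(\<integral>x. f (exp_neg x) \<partial>M) - (\<integral>x. f (exp_neg x) \<partial>N)\<bar> \<le> 0"
    by (rule field_le_epsilon)
  then show ?thesis by simp
qed

text \<open>
  The orthant below \<open>x\<close> corresponds to the closed set \<open>C\<close> of all \<open>u\<close> above \<open>exp_neg x\<close>. Its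
  indicator is the pointwise limit of continuous functions, truncations of the distance to \<open>C\<close>, whose
  integrals agree.
\<close>
lemma joint_cdf_eq_of_laplace_eq:
  fixes M N :: "(real ^ 'n) measure"
  assumes M: "prob_space M" "sets M = sets borel" "measure M pos_orthant = 1"
    and N: "prob_space N" "sets N = sets borel" "measure N pos_orthant = 1"
    and laplace: "\<And>t. (\<And>i. 0 \<le> t $ i) \<Longrightarrow>
        (\<integral>x. exp (- (\<Sum>i\<in>UNIV. t $ i * x $ i)) \<partial>M) = (\<integral>x. exp (- (\<Sum>i\<in>UNIV. t $ i * x $ i)) \<partial>N)"
  shows "joint_cdf M = joint_cdf N"
proof
  fix x :: "real ^ 'n"
  define C where "C = (\<Inter>i. {u :: real ^ 'n. exp_neg x $ i \<le> u $ i})"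
  have C: "closed C" unfolding C_def by (intro closed_INT ballI closed_Collect_le continuous_intros)
  have C_ne: "C \<noteq> {}" unfolding C_def by (auto intro!: exI[of _ "exp_neg x"])
  define f where "f = (\<lambda>(k::nat) u. max 0 (1 - real k * infdist u C))"
  have f_cont: "continuous_on UNIV (f k)" for k
    unfolding f_def by (intro continuous_intros)
  have f_lim: "(\<lambda>k. f k u) \<longlonglongrightarrow> indicator C u" for u
  proof (cases "u \<in> C")
    case True
    then show ?thesis by (simp add: f_def)
  next
    case False
    then have pos: "0 < infdist u C"
      using infdist_nonneg[of u C] in_closed_iff_infdist_zero[OF C C_ne, of u] by auto
    obtain k0 :: nat where "1 / infdist u C < real k0"
      using reals_Archimedean2 by blast
    then have "f k u = 0" if "k0 \<le> k" for k
    proof -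
      have "1 / infdist u C < real k"
        using \<open>1 / infdist u C < real k0\<close> that by linarith
      with pos show ?thesis by (simp add: f_def field_simps)
    qed
    then have "\<forall>\<^sub>F k in sequentially. f k u = indicator C u"
      using False by (auto simp: eventually_sequentially)
    then show ?thesis by (rule tendsto_eventually)
  qed
  have lim: "(\<lambda>k. \<integral>y. f k (exp_neg y) \<partial>L) \<longlonglongrightarrow> joint_cdf L x"
    if L: "prob_space L" "sets L = sets borel" for L
  proof -
    interpret prob_space L by fact
    note [measurable_cong] = L(2)
    have [measurable]: "f k \<in> borel_measurable borel" for k
      using f_cont by (rule borel_measurable_continuous_onI)
    have [measurable]: "C \<in> sets borel" using C by (rule borel_closed)
    have "(\<lambda>k. \<integral>y. f k (exp_neg y) \<partial>L) \<longlonglongrightarrow> (\<integral>y. indicator C (exp_neg y) \<partial>L)"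
      by (rule integral_dominated_convergence[where w = "\<lambda>_. 1"])
         (auto simp: f_lim, auto simp: f_def infdist_nonneg)
    also have "(\<integral>y. indicator C (exp_neg y) \<partial>L) = (\<integral>y. indicator {..x} y \<partial>L)"
      by (intro Bochner_Integration.integral_cong)
         (auto simp: indicator_def C_def exp_neg_def less_eq_vec_def)
    also have "\<dots> = joint_cdf L x"
      using sets_eq_imp_space_eq[OF L(2)] by (simp add: joint_cdf_def L)
    finally show ?thesis .
  qed
  have "(\<integral>y. f k (exp_neg y) \<partial>M) = (\<integral>y. f k (exp_neg y) \<partial>N)" for k
    by (rule integral_continuous_exp_neg_eq[OF M N laplace f_cont])
  with lim[OF M(1,2)] lim[OF N(1,2)] show "joint_cdf M x = joint_cdf N x"
    using LIMSEQ_unique by force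
qed

section \<open>Non-central gamma kernels\<close>

text \<open>
  The argument \<open>s\<close> is the shape and \<open>c\<close> is the scale, that is, the reciprocal of the rate.
\<close>
definition gamma_pdf :: "real \<Rightarrow> real \<Rightarrow> real \<Rightarrow> real" where
  "gamma_pdf s c x = indicator {0<..} x * (x powr (s - 1) * exp (- x / c) / (Gamma s * c powr s))"

text \<open>
  The probability of \<open>m\<close> under the Poisson distribution with mean \<open>l * y\<close>. It is cut off at \<open>y \<le> 0\<close>, where
  the formula would take negative values.
\<close>
definition poisson_weight :: "real \<Rightarrow> nat \<Rightarrow> real \<Rightarrow> real" where
  "poisson_weight l m y = indicator {0<..} y * (exp (- (l * y)) * (l * y) ^ m / fact m)"

definition noncentral_gamma_pdf :: "real \<Rightarrow> real \<Rightarrow> real \<Rightarrow> real \<Rightarrow> real \<Rightarrow> ennreal" where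
  "noncentral_gamma_pdf \<alpha> c l x y =
     (\<Sum>m. ennreal (gamma_pdf (\<alpha> + real m) c x) * ennreal (poisson_weight l m y))"

lemma measurable_gamma_pdf [measurable]: "gamma_pdf s c \<in> borel_measurable borel"
  unfolding gamma_pdf_def by measurable

lemma measurable_poisson_weight [measurable]: "poisson_weight l m \<in> borel_measurable borel"
  unfolding poisson_weight_def by measurable

lemma measurable_noncentral_gamma_pdf [measurable (raw)]:
  assumes [measurable]: "f \<in> borel_measurable M" "g \<in> borel_measurable M"
  shows "(\<lambda>z. noncentral_gamma_pdf \<alpha> c l (f z) (g z)) \<in> borel_measurable M"
  unfolding noncentral_gamma_pdf_def by measurable

lemma gamma_pdf_nonneg: "0 < s \<Longrightarrow> 0 \<le> gamma_pdf s c x"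
  unfolding gamma_pdf_def by (simp add: less_imp_le)

lemma poisson_weight_nonneg: "0 \<le> l \<Longrightarrow> 0 \<le> poisson_weight l m y"
  unfolding poisson_weight_def by (simp add: indicator_def)

lemma TP2_gamma_pdf:
  assumes "0 < \<alpha>"
  shows "TP2 (\<lambda>x m. ennreal (gamma_pdf (\<alpha> + real m) c x))"
proof (rule TP2_power)
  show "ennreal (gamma_pdf (\<alpha> + real m) c x) =
      ennreal (1 / (Gamma (\<alpha> + real m) * c powr (\<alpha> + real m)) * (x powr (\<alpha> - 1) * exp (- x / c)) * x ^ m)"
    if "0 < x" for x m
  proof -
    have "x powr (\<alpha> + real m - 1) = x powr (\<alpha> - 1) * x ^ m"
      using that powr_add[of x "\<alpha> - 1" "real m"] by (simp add: powr_realpow algebra_simps)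
    with that show ?thesis by (simp add: gamma_pdf_def mult_ac)
  qed
  show "0 \<le> 1 / (Gamma (\<alpha> + real m) * c powr (\<alpha> + real m))" for m
    using assms by (simp add: less_imp_le)
qed (simp_all add: gamma_pdf_def)

lemma TP2_poisson_weight:
  assumes "0 \<le> l"
  shows "TP2 (\<lambda>m y. ennreal (poisson_weight l m y))"
proof (rule TP2_swap, rule TP2_power)
  show "ennreal (poisson_weight l m y) = ennreal (l ^ m / fact m * exp (- (l * y)) * y ^ m)"
    if "0 < y" for y m
    using that by (simp add: poisson_weight_def power_mult_distrib mult_ac)
qed (use assms in \<open>simp_all add: poisson_weight_def\<close>)

lemma TP2_noncentral_gamma_pdf:
  assumes "0 < \<alpha>" "0 \<le> l"
  shows "TP2 (noncentral_gamma_pdf \<alpha> c l)"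
proof -
  have "TP2 (\<lambda>x y. \<integral>\<^sup>+m. ennreal (gamma_pdf (\<alpha> + real m) c x) * ennreal (poisson_weight l m y)
      \<partial>count_space UNIV)"
    by (rule TP2_compose[OF TP2_gamma_pdf[OF assms(1)] TP2_poisson_weight[OF assms(2)]]) simp_all
  then show ?thesis
    by (simp add: nn_integral_count_space_nat noncentral_gamma_pdf_def[abs_def])
qed

lemma TP2_noncentral_gamma_cdf:
  assumes "0 < \<alpha>" "0 \<le> l"
  shows "TP2 (\<lambda>x y. \<integral>\<^sup>+u. indicator {..x} u * noncentral_gamma_pdf \<alpha> c l u y \<partial>lborel)"
  by (rule TP2_compose[OF TP2_indicator_atMost TP2_noncentral_gamma_pdf[OF assms]]) measurable

lemma nn_integral_powr_exp:
  assumes "0 < s" "0 < b"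
  shows "(\<integral>\<^sup>+x. ennreal (indicator {0<..} x * (x powr (s - 1) * exp (- (b * x)))) \<partial>lborel)
    = ennreal (Gamma s / b powr s)"
proof -
  have "ennreal (Gamma s) = (\<integral>\<^sup>+t. ennreal (indicator {0..} t * t powr (s - 1) / exp t) \<partial>lborel)"
    by (rule Gamma_conv_nn_integral_real[OF assms(1)])
  also have "\<dots> = ennreal \<bar>b\<bar> * (\<integral>\<^sup>+x. ennreal (indicator {0..} (0 + b * x) * (0 + b * x) powr (s - 1) / exp (0 + b * x)) \<partial>lborel)"
    using assms by (intro nn_integral_real_affine) auto
  also have "\<dots> = ennreal b * (\<integral>\<^sup>+x. ennreal (b powr (s - 1)) *
      ennreal (indicator {0<..} x * (x powr (s - 1) * exp (- (b * x)))) \<partial>lborel)"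
  proof -
    have "ennreal (indicator {0..} (0 + b * x) * (0 + b * x) powr (s - 1) / exp (0 + b * x))
        = ennreal (b powr (s - 1)) * ennreal (indicator {0<..} x * (x powr (s - 1) * exp (- (b * x))))" for x
    proof (cases "0 < x")
      case True
      with assms have "0 < b * x" by simp
      with True assms show ?thesis
        by (simp add: powr_mult exp_minus field_simps less_imp_le flip: ennreal_mult)
    next
      case False
      then show ?thesis
        using assms by (cases "x = 0") (auto simp: indicator_def zero_le_mult_iff)
    qed
    with assms show ?thesis by simp
  qed
  also have "\<dots> = ennreal (b powr s) * (\<integral>\<^sup>+x. ennreal (indicator {0<..} x * (x powr (s - 1) * exp (- (b * x)))) \<partial>lborel)"
  proof -
    have "ennreal b * ennreal (b powr (s - 1)) = ennreal (b powr s)"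
      using assms powr_add[of b 1 "s - 1"] by (simp flip: ennreal_mult)
    then show ?thesis
      by (subst nn_integral_cmult) (simp_all flip: mult.assoc)
  qed
  finally have eq: "ennreal (Gamma s) = ennreal (b powr s) * (\<integral>\<^sup>+x. ennreal (indicator {0<..} x * (x powr (s - 1) * exp (- (b * x)))) \<partial>lborel)" .
  have "ennreal (Gamma s / b powr s) = ennreal (1 / b powr s) * ennreal (Gamma s)"
    using assms by (simp add: less_imp_le flip: ennreal_mult)
  also have "\<dots> = (ennreal (1 / b powr s) * ennreal (b powr s)) * (\<integral>\<^sup>+x. ennreal (indicator {0<..} x * (x powr (s - 1) * exp (- (b * x)))) \<partial>lborel)"
    by (simp add: eq mult.assoc)
  also have "ennreal (1 / b powr s) * ennreal (b powr s) = 1"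
    using assms by (simp flip: ennreal_mult)
  finally show ?thesis by simp
qed

lemma nn_integral_exp_gamma_pdf:
  assumes "0 < s" "0 < c" "0 < 1 + c * t"
  shows "(\<integral>\<^sup>+x. ennreal (exp (- (t * x))) * ennreal (gamma_pdf s c x) \<partial>lborel) = ennreal ((1 + c * t) powr - s)"
proof -
  define b where "b = (1 + c * t) / c"
  have b: "0 < b" using assms by (simp add: b_def)
  have "ennreal (exp (- (t * x))) * ennreal (gamma_pdf s c x) = ennreal (1 / (Gamma s * c powr s)) *
      ennreal (indicator {0<..} x * (x powr (s - 1) * exp (- (b * x))))" for x
  proof -
    have "exp (- (b * x)) = exp (- (t * x)) * exp (- x / c)"
      using assms by (simp add: b_def field_simps flip: exp_add)
    then show ?thesis
      using assms by (simp add: gamma_pdf_def indicator_def less_imp_le flip: ennreal_mult)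
  qed
  then have "(\<integral>\<^sup>+x. ennreal (exp (- (t * x))) * ennreal (gamma_pdf s c x) \<partial>lborel)
      = ennreal (1 / (Gamma s * c powr s)) * ennreal (Gamma s / b powr s)"
    using nn_integral_powr_exp[OF assms(1) b] by (simp add: nn_integral_cmult)
  also have "\<dots> = ennreal (1 / (c powr s * b powr s))"
  proof -
    have "Gamma s \<noteq> 0" using Gamma_real_pos[OF assms(1)] by linarith
    then show ?thesis using assms by (simp add: less_imp_le flip: ennreal_mult)
  qed
  also have "c powr s * b powr s = (1 + c * t) powr s"
    using assms b powr_mult[of c b s] by (simp add: b_def)
  finally show ?thesis by (simp add: powr_minus_divide)
qed

text \<open>
  Summing the gamma transforms \<open>(1 + c t)\<^bsup>-(\<alpha> + m)\<^esup>\<close> against the Poisson weights is an exponential series in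
  \<open>l y / (1 + c t)\<close>.
\<close>
lemma nn_integral_exp_noncentral_gamma_pdf:
  assumes "0 < \<alpha>" "0 < c" "0 \<le> l" "0 < 1 + c * t"
  shows "(\<integral>\<^sup>+x. ennreal (exp (- (t * x))) * noncentral_gamma_pdf \<alpha> c l x y \<partial>lborel)
    = ennreal (indicator {0<..} y * ((1 + c * t) powr - \<alpha> * exp (- (l * c * t / (1 + c * t) * y))))"
proof (cases "0 < y")
  case False
  then show ?thesis by (simp add: noncentral_gamma_pdf_def poisson_weight_def)
next
  case True
  let ?q = "1 + c * t"
  have "(\<integral>\<^sup>+x. ennreal (exp (- (t * x))) * noncentral_gamma_pdf \<alpha> c l x y \<partial>lborel)
      = (\<Sum>m. \<integral>\<^sup>+x. ennreal (poisson_weight l m y) *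
           (ennreal (exp (- (t * x))) * ennreal (gamma_pdf (\<alpha> + real m) c x)) \<partial>lborel)"
    unfolding noncentral_gamma_pdf_def ennreal_suminf_cmult[symmetric]
    by (subst nn_integral_suminf[symmetric]) (simp_all add: mult_ac)
  also have "\<dots> = (\<Sum>m. ennreal (poisson_weight l m y * ?q powr - (\<alpha> + real m)))"
    using assms
    by (simp add: nn_integral_cmult nn_integral_exp_gamma_pdf ennreal_mult poisson_weight_nonneg)
  also have "\<dots> = (\<Sum>m. ennreal (?q powr - \<alpha> * exp (- (l * y)) * ((l * y / ?q) ^ m /\<^sub>R fact m)))"
  proof -
    have "?q powr - (\<alpha> + real m) = ?q powr - \<alpha> / ?q ^ m" for m
      using assms powr_add[of ?q "- \<alpha>" "- real m"]
      by (simp add: powr_minus_divide powr_realpow)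
    then show ?thesis
      using True by (simp add: poisson_weight_def power_divide field_simps)
  qed
  also have "\<dots> = ennreal (?q powr - \<alpha> * exp (- (l * y)) * exp (l * y / ?q))"
    using True assms by (intro suminf_ennreal_eq sums_mult exp_converges) auto
  also have "?q powr - \<alpha> * exp (- (l * y)) * exp (l * y / ?q) = ?q powr - \<alpha> * exp (- (l * c * t / ?q * y))"
  proof -
    have "- (l * y) + l * y / ?q = - (l * c * t / ?q * y)"
      using assms by (simp add: field_simps)
    then show ?thesis
      by (simp only: mult.assoc flip: exp_add)
  qed
  finally show ?thesis
    using True by (simp add: mult.assoc)
qed

section \<open>The gamma mixture\<close>

definition gamma_mixture :: "real \<Rightarrow> real ^ 'n \<Rightarrow> (real ^ 'n) measure" where
  "gamma_mixture \<alpha> a = density lborel (\<lambda>x. \<integral>\<^sup>+y. ennreal (gamma_pdf \<alpha> 1 y) *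
     (\<Prod>i\<in>UNIV. noncentral_gamma_pdf \<alpha> (1 - (a $ i)\<^sup>2) ((a $ i)\<^sup>2 / (1 - (a $ i)\<^sup>2)) (x $ i) y) \<partial>lborel)"

lemma nn_integral_lborel_vec_prod:
  fixes f :: "'n::finite \<Rightarrow> real \<Rightarrow> ennreal"
  assumes [measurable]: "\<And>i. f i \<in> borel_measurable borel"
  shows "(\<integral>\<^sup>+x. (\<Prod>i\<in>UNIV. f i (x $ i)) \<partial>lborel) = (\<Prod>i\<in>UNIV. \<integral>\<^sup>+u. f i u \<partial>lborel)"
proof -
  define index where "index = (\<lambda>b::real ^ 'n. THE i. b = axis i 1)"
  have index: "index (axis i 1) = i" for i
    by (simp add: index_def axis_eq_axis)
  have basis: "(\<Prod>b\<in>Basis. g b) = (\<Prod>i\<in>UNIV. g (axis i 1))" for g :: "real ^ 'n \<Rightarrow> ennreal"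
  proof -
    have "(Basis :: (real ^ 'n) set) = range (\<lambda>i. axis i 1)"
      by (auto simp: Basis_vec_def)
    moreover have "inj (\<lambda>i. axis i 1 :: real ^ 'n)"
      by (auto simp: inj_def axis_eq_axis)
    ultimately show ?thesis by (metis (no_types, lifting) prod.reindex_cong)
  qed
  show ?thesis
    using nn_integral_lborel_prod[of "\<lambda>b. f (index b)"]
    by (simp add: basis index inner_axis)
qed

lemma sets_gamma_mixture [simp, measurable_cong]: "sets (gamma_mixture \<alpha> a) = sets borel"
  by (simp add: gamma_mixture_def)

lemma borel_measurable_vec_nth_raw [measurable (raw)]:
  fixes f :: "'a \<Rightarrow> real ^ 'n"
  shows "f \<in> borel_measurable M \<Longrightarrow> (\<lambda>x. f x $ i) \<in> borel_measurable M"
  by (rule measurable_compose[of f M borel])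
     (auto intro!: borel_measurable_continuous_onI continuous_intros)

text \<open>
  Tonelli's theorem and conditional independence given \<open>y\<close>. Both the Laplace transform and the cdf are
  integrals of products of one-variable functions, hence instances of this formula.
\<close>
lemma nn_integral_gamma_mixture:
  fixes \<phi> :: "'n::finite \<Rightarrow> real \<Rightarrow> ennreal" and a :: "real ^ 'n"
  assumes [measurable]: "\<And>i. \<phi> i \<in> borel_measurable borel"
  shows "(\<integral>\<^sup>+x. (\<Prod>i\<in>UNIV. \<phi> i (x $ i)) \<partial>gamma_mixture \<alpha> a) =
    (\<integral>\<^sup>+y. ennreal (gamma_pdf \<alpha> 1 y) * (\<Prod>i\<in>UNIV. \<integral>\<^sup>+u. \<phi> i u *
       noncentral_gamma_pdf \<alpha> (1 - (a $ i)\<^sup>2) ((a $ i)\<^sup>2 / (1 - (a $ i)\<^sup>2)) u y \<partial>lborel) \<partial>lborel)"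
proof -
  let ?h = "\<lambda>i. noncentral_gamma_pdf \<alpha> (1 - (a $ i)\<^sup>2) ((a $ i)\<^sup>2 / (1 - (a $ i)\<^sup>2))"
  have "(\<integral>\<^sup>+x. (\<Prod>i\<in>UNIV. \<phi> i (x $ i)) \<partial>gamma_mixture \<alpha> a)
      = (\<integral>\<^sup>+x. (\<integral>\<^sup>+y. ennreal (gamma_pdf \<alpha> 1 y) * (\<Prod>i\<in>UNIV. ?h i (x $ i) y) \<partial>lborel) *
          (\<Prod>i\<in>UNIV. \<phi> i (x $ i)) \<partial>lborel)"
    unfolding gamma_mixture_def by (subst nn_integral_density) simp_all
  also have "\<dots> = (\<integral>\<^sup>+x. \<integral>\<^sup>+y. ennreal (gamma_pdf \<alpha> 1 y) *
      (\<Prod>i\<in>UNIV. \<phi> i (x $ i) * ?h i (x $ i) y) \<partial>lborel \<partial>lborel)"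
    by (intro nn_integral_cong, subst nn_integral_multc[symmetric])
       (simp_all add: prod.distrib mult_ac)
  also have "\<dots> = (\<integral>\<^sup>+y. \<integral>\<^sup>+x. ennreal (gamma_pdf \<alpha> 1 y) *
      (\<Prod>i\<in>UNIV. \<phi> i (x $ i) * ?h i (x $ i) y) \<partial>lborel \<partial>lborel)"
    by (rule lborel_pair.Fubini') measurable
  also have "\<dots> = (\<integral>\<^sup>+y. ennreal (gamma_pdf \<alpha> 1 y) *
      (\<Prod>i\<in>UNIV. \<integral>\<^sup>+u. \<phi> i u * ?h i u y \<partial>lborel) \<partial>lborel)"
    by (intro nn_integral_cong, subst nn_integral_cmult)
       (simp_all add: nn_integral_lborel_vec_prod[of "\<lambda>i u. \<phi> i u * ?h i u y" for y])
  finally show ?thesis .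
qed

lemma emeasure_gamma_mixture_box:
  fixes a :: "real ^ 'n"
  assumes [measurable]: "\<And>i. S i \<in> sets borel"
  shows "emeasure (gamma_mixture \<alpha> a) {x. \<forall>i. x $ i \<in> S i} =
    (\<integral>\<^sup>+y. ennreal (gamma_pdf \<alpha> 1 y) * (\<Prod>i\<in>UNIV. \<integral>\<^sup>+u. indicator (S i) u *
       noncentral_gamma_pdf \<alpha> (1 - (a $ i)\<^sup>2) ((a $ i)\<^sup>2 / (1 - (a $ i)\<^sup>2)) u y \<partial>lborel) \<partial>lborel)"
proof -
  have indicator_box: "indicator {x. \<forall>i. x $ i \<in> S i} x = (\<Prod>i\<in>UNIV. indicator (S i) (x $ i) :: ennreal)" for x :: "real ^ 'n"
  proof (cases "\<forall>i. x $ i \<in> S i")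
    case False
    then obtain i where "x $ i \<notin> S i" by auto
    then have "indicator (S i) (x $ i) = (0 :: ennreal)" by simp
    then have "(\<Prod>i\<in>UNIV. indicator (S i) (x $ i) :: ennreal) = 0"
      by (intro prod_zero) auto
    with False show ?thesis by simp
  qed simp
  have box: "{x :: real ^ 'n. \<forall>i. x $ i \<in> S i} \<in> sets borel"
    by measurable
  have "emeasure (gamma_mixture \<alpha> a) {x. \<forall>i. x $ i \<in> S i} =
      (\<integral>\<^sup>+x. indicator {x. \<forall>i. x $ i \<in> S i} x \<partial>gamma_mixture \<alpha> a)"
    using box by (intro nn_integral_indicator[symmetric]) (simp only: sets_gamma_mixture)
  also have "\<dots> = (\<integral>\<^sup>+x. (\<Prod>i\<in>UNIV. indicator (S i) (x $ i)) \<partial>gamma_mixture \<alpha> a)"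
    unfolding indicator_box ..
  also note nn_integral_gamma_mixture
  finally show ?thesis by simp
qed

text \<open>
  The conditional transform given \<open>y\<close> is \<open>exp (- S y)\<close> times a factor free of \<open>y\<close>, so that the outer
  integral is the Laplace transform of the standard gamma distribution at \<open>S\<close>.
\<close>
lemma laplace_gamma_mixture:
  fixes a t :: "real ^ 'n"
  assumes \<alpha>: "0 < \<alpha>" and a: "\<And>i. 0 < a $ i \<and> a $ i < 1" and t: "\<And>i. 0 \<le> t $ i"
  shows "(\<integral>\<^sup>+x. ennreal (exp (- (\<Sum>i\<in>UNIV. t $ i * x $ i))) \<partial>gamma_mixture \<alpha> a)
    = ennreal (det (mat 1 + (diag_mat (\<chi> i. 1 - (a $ i)\<^sup>2) + outer_prod a a) ** diag_mat t) powr - \<alpha>)"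
proof -
  define c where "c = (\<lambda>i. 1 - (a $ i)\<^sup>2)"
  define q where "q = (\<lambda>i. 1 + c i * t $ i)"
  define S where "S = (\<Sum>i\<in>UNIV. (a $ i)\<^sup>2 * t $ i / q i)"
  have c: "0 < c i" for i
    using a[of i] by (simp add: c_def power_less_one_iff abs_square_less_1)
  have q: "0 < q i" for i
    using c[of i] t[of i] by (simp add: q_def add_pos_nonneg)
  have S: "0 \<le> S"
    unfolding S_def using t q by (intro sum_nonneg divide_nonneg_pos mult_nonneg_nonneg) auto
  have inner: "(\<integral>\<^sup>+u. ennreal (exp (- (t $ i * u))) * noncentral_gamma_pdf \<alpha> (c i) ((a $ i)\<^sup>2 / c i) u y \<partial>lborel)
      = ennreal (q i powr - \<alpha> * exp (- ((a $ i)\<^sup>2 * t $ i / q i * y)))" if "0 < y" for i y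
    using nn_integral_exp_noncentral_gamma_pdf[OF \<alpha> c, of "(a $ i)\<^sup>2 / c i" i "t $ i" y] c[of i] q[of i] that
    by (simp add: q_def)
  have "(\<integral>\<^sup>+x. ennreal (exp (- (\<Sum>i\<in>UNIV. t $ i * x $ i))) \<partial>gamma_mixture \<alpha> a)
      = (\<integral>\<^sup>+x. (\<Prod>i\<in>UNIV. ennreal (exp (- (t $ i * x $ i)))) \<partial>gamma_mixture \<alpha> a)"
    by (simp add: prod_ennreal exp_sum flip: sum_negf)
  also have "\<dots> = (\<integral>\<^sup>+y. ennreal (gamma_pdf \<alpha> 1 y) * (\<Prod>i\<in>UNIV.
      \<integral>\<^sup>+u. ennreal (exp (- (t $ i * u))) * noncentral_gamma_pdf \<alpha> (c i) ((a $ i)\<^sup>2 / c i) u y \<partial>lborel) \<partial>lborel)"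
    unfolding c_def by (rule nn_integral_gamma_mixture) measurable
  also have "\<dots> = (\<integral>\<^sup>+y. ennreal (\<Prod>i\<in>UNIV. q i powr - \<alpha>) *
      (ennreal (exp (- (S * y))) * ennreal (gamma_pdf \<alpha> 1 y)) \<partial>lborel)"
  proof (rule nn_integral_cong)
    fix y :: real
    show "ennreal (gamma_pdf \<alpha> 1 y) * (\<Prod>i\<in>UNIV.
        \<integral>\<^sup>+u. ennreal (exp (- (t $ i * u))) * noncentral_gamma_pdf \<alpha> (c i) ((a $ i)\<^sup>2 / c i) u y \<partial>lborel)
      = ennreal (\<Prod>i\<in>UNIV. q i powr - \<alpha>) * (ennreal (exp (- (S * y))) * ennreal (gamma_pdf \<alpha> 1 y))"
    proof (cases "0 < y")
      case True
      have "(\<Prod>i\<in>UNIV. exp (- ((a $ i)\<^sup>2 * t $ i / q i * y))) = exp (- (S * y))"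
        by (simp add: S_def sum_distrib_right exp_sum flip: sum_negf)
      then have "(\<Prod>i\<in>UNIV. ennreal (q i powr - \<alpha> * exp (- ((a $ i)\<^sup>2 * t $ i / q i * y))))
          = ennreal ((\<Prod>i\<in>UNIV. q i powr - \<alpha>) * exp (- (S * y)))"
        by (subst prod_ennreal) (simp_all only: prod.distrib powr_ge_zero exp_ge_zero mult_nonneg_nonneg)
      also have "\<dots> = ennreal (\<Prod>i\<in>UNIV. q i powr - \<alpha>) * ennreal (exp (- (S * y)))"
        by (intro ennreal_mult prod_nonneg) auto
      finally have product: "(\<Prod>i\<in>UNIV. ennreal (q i powr - \<alpha> * exp (- ((a $ i)\<^sup>2 * t $ i / q i * y))))
          = ennreal (\<Prod>i\<in>UNIV. q i powr - \<alpha>) * ennreal (exp (- (S * y)))" .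
      show ?thesis
        unfolding inner[OF True] product by (simp only: mult_ac)
    qed (simp add: gamma_pdf_def)
  qed
  also have "\<dots> = ennreal ((\<Prod>i\<in>UNIV. q i powr - \<alpha>) * (1 + S) powr - \<alpha>)"
    using nn_integral_exp_gamma_pdf[OF \<alpha>, of 1 S] S
    by (simp add: nn_integral_cmult ennreal_mult prod_nonneg)
  also have "(\<Prod>i\<in>UNIV. q i powr - \<alpha>) * (1 + S) powr - \<alpha> = ((\<Prod>i\<in>UNIV. q i) * (1 + S)) powr - \<alpha>"
    using q S by (simp add: powr_mult prod_nonneg prod_powr_distrib less_imp_le)
  also have "(\<Prod>i\<in>UNIV. q i) * (1 + S) =
      det (mat 1 + (diag_mat (\<chi> i. 1 - (a $ i)\<^sup>2) + outer_prod a a) ** diag_mat t)"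
    by (subst det_one_plus_one_factor) (use q in \<open>simp_all add: q_def c_def S_def\<close>)
  finally show ?thesis .
qed

lemma gamma_distribution_gamma_mixture:
  fixes a :: "real ^ 'n"
  assumes \<alpha>: "0 < \<alpha>" and a: "\<And>i. 0 < a $ i \<and> a $ i < 1"
  shows "gamma_distribution \<alpha> (diag_mat (\<chi> i. 1 - (a $ i)\<^sup>2) + outer_prod a a) (gamma_mixture \<alpha> a)"
proof -
  let ?M = "gamma_mixture \<alpha> a"
  \<comment> \<open>The total mass is the Laplace transform at zero.\<close>
  have zero: "(mat 1 + (diag_mat (\<chi> i. 1 - (a $ i)\<^sup>2) + outer_prod a a) ** diag_mat (0 :: real ^ 'n)) = mat 1"
    by (simp add: vec_eq_iff matrix_matrix_mult_def diag_mat_def if_distrib cong: if_cong)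
  have space: "space ?M = UNIV" by (simp add: gamma_mixture_def)
  have "emeasure ?M UNIV = 1"
    using laplace_gamma_mixture[OF assms, of 0] space by (simp add: zero)
  then interpret prob_space ?M
    by (intro prob_spaceI) (simp add: space)
  have pos_sets [measurable]: "(pos_orthant :: (real ^ 'n) set) \<in> sets borel"
    unfolding pos_orthant_def by measurable
  have "indicator {0<..} u * noncentral_gamma_pdf \<alpha> c l u y = indicator UNIV u * noncentral_gamma_pdf \<alpha> c l u y"
    for c l u y
    by (simp add: noncentral_gamma_pdf_def gamma_pdf_def indicator_def)
  then have "emeasure ?M pos_orthant = emeasure ?M UNIV"
    using emeasure_gamma_mixture_box[of "\<lambda>_. {0<..}" \<alpha> a] emeasure_gamma_mixture_box[of "\<lambda>_. UNIV" \<alpha> a]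
    by (simp add: pos_orthant_def)
  also have "\<dots> = 1" using emeasure_space_1 by (simp add: space)
  finally have pos: "measure ?M pos_orthant = 1"
    by (simp add: measure_def)
  have "(\<integral>x. exp (- (\<Sum>i\<in>UNIV. t $ i * x $ i)) \<partial>?M)
      = det (mat 1 + (diag_mat (\<chi> i. 1 - (a $ i)\<^sup>2) + outer_prod a a) ** diag_mat t) powr - \<alpha>"
    if "\<forall>i. 0 \<le> t $ i" for t
    using laplace_gamma_mixture[OF assms, of t] that
    by (subst integral_eq_nn_integral) auto
  with pos show ?thesis
    unfolding gamma_distribution_def using prob_space_axioms by simp
qed

lemma noncentral_gamma_pdf_pos:
  assumes "0 < \<alpha>" "0 < c" "0 < l" "0 < x" "0 < y"
  shows "0 < noncentral_gamma_pdf \<alpha> c l x y"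
proof -
  have "0 < gamma_pdf \<alpha> c x * poisson_weight l 0 y"
    using assms by (simp add: gamma_pdf_def poisson_weight_def)
  then have "0 < ennreal (gamma_pdf (\<alpha> + real 0) c x) * ennreal (poisson_weight l 0 y)"
    using assms by (simp add: gamma_pdf_nonneg flip: ennreal_mult')
  also have "\<dots> \<le> noncentral_gamma_pdf \<alpha> c l x y"
    unfolding noncentral_gamma_pdf_def
    using sum_le_suminf[of "\<lambda>m. ennreal (gamma_pdf (\<alpha> + real m) c x) * ennreal (poisson_weight l m y)" "{0}"]
    by simp
  finally show ?thesis .
qed

lemma nn_integral_pos_of_interval:
  fixes f :: "real \<Rightarrow> ennreal"
  assumes [measurable]: "f \<in> borel_measurable borel"
    and "l < r" and pos: "\<And>u. l < u \<Longrightarrow> u < r \<Longrightarrow> 0 < f u"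
  shows "0 < (\<integral>\<^sup>+u. f u \<partial>lborel)"
proof (rule ccontr)
  assume "\<not> 0 < (\<integral>\<^sup>+u. f u \<partial>lborel)"
  then have "AE u in lborel. f u = 0"
    by (simp add: nn_integral_0_iff_AE)
  then have "AE u in lborel. u \<notin> {l<..<r}"
    by eventually_elim (use pos in force)
  then have "{l<..<r} \<in> null_sets lborel"
    by (subst AE_iff_null_sets) auto
  then have "emeasure lborel {l<..<r} = 0" by blast
  with \<open>l < r\<close> show False by simp
qed

lemma prod_pos_ennreal:
  fixes f :: "'i \<Rightarrow> ennreal"
  shows "(\<And>i. i \<in> A \<Longrightarrow> 0 < f i) \<Longrightarrow> 0 < prod f A"
  by (induction A rule: infinite_finite_induct) (auto simp: ennreal_zero_less_mult_iff)

lemma MTP2_joint_cdf_gamma_mixture: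
  fixes a :: "real ^ 'n"
  assumes \<alpha>: "0 < \<alpha>" and a: "\<And>i. 0 < a $ i \<and> a $ i < 1"
  shows "MTP2 (joint_cdf (gamma_mixture \<alpha> a))"
proof -
  let ?M = "gamma_mixture \<alpha> a"
  interpret prob_space ?M
    using gamma_distribution_gamma_mixture[OF assms] by (simp add: gamma_distribution_def)
  define c where "c = (\<lambda>i. 1 - (a $ i)\<^sup>2)"
  define l where "l = (\<lambda>i. (a $ i)\<^sup>2 / c i)"
  have c: "0 < c i" and l: "0 < l i" for i
    using a[of i] by (simp_all add: l_def c_def power_less_one_iff abs_square_less_1)
  define H where "H = (\<lambda>i x y. \<integral>\<^sup>+u. indicator {..x} u * noncentral_gamma_pdf \<alpha> (c i) (l i) u y \<partial>lborel)"
  have H_meas [measurable]: "H i r \<in> borel_measurable borel" for i r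
    unfolding H_def by measurable
  have F: "ennreal (joint_cdf ?M x) = (\<integral>\<^sup>+y. ennreal (gamma_pdf \<alpha> 1 y) * (\<Prod>i\<in>UNIV. H i (x $ i) y) \<partial>lborel)" for x
    using emeasure_gamma_mixture_box[of "\<lambda>i. {..x $ i}" \<alpha> a]
    by (simp add: joint_cdf_def emeasure_eq_measure[symmetric] H_def l_def c_def less_eq_vec_def atMost_def)
  have H_pos: "0 < H i x y" if "0 < x" "0 < y" for i x y
    unfolding H_def
    by (rule nn_integral_pos_of_interval[of _ 0 x])
       (use that in \<open>auto simp: indicator_def intro!: noncentral_gamma_pdf_pos \<alpha> c l\<close>)
  have "0 < joint_cdf ?M x" if "x \<in> pos_orthant" for x
  proof -
    have "0 < (\<integral>\<^sup>+y. ennreal (gamma_pdf \<alpha> 1 y) * (\<Prod>i\<in>UNIV. H i (x $ i) y) \<partial>lborel)"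
    proof (rule nn_integral_pos_of_interval[of _ 0 1])
      fix y :: real assume "0 < y" "y < 1"
      moreover have "0 < gamma_pdf \<alpha> 1 y"
        using \<open>0 < y\<close> \<alpha> by (simp add: gamma_pdf_def)
      ultimately show "0 < ennreal (gamma_pdf \<alpha> 1 y) * (\<Prod>i\<in>UNIV. H i (x $ i) y)"
        using that by (auto simp: ennreal_zero_less_mult_iff pos_orthant_def intro!: prod_pos_ennreal H_pos)
    qed auto
    then show ?thesis by (simp flip: F)
  qed
  moreover have "joint_cdf ?M x * joint_cdf ?M y \<le> joint_cdf ?M (sup x y) * joint_cdf ?M (inf x y)" for x y
  proof -
    have "TP2 (H i)" for i
      unfolding H_def using \<alpha> l[of i] by (intro TP2_noncentral_gamma_cdf) auto
    then have "ennreal (joint_cdf ?M x) * ennreal (joint_cdf ?M y)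
        \<le> ennreal (joint_cdf ?M (sup x y)) * ennreal (joint_cdf ?M (inf x y))"
      unfolding F by (intro marginal_log_supermodular) auto
    then show ?thesis
      by (simp add: joint_cdf_def flip: ennreal_mult)
  qed
  ultimately show ?thesis by (simp add: MTP2_def)
qed

lemma gamma_distribution_MTP2:
  fixes a :: "real ^ 'n"
  assumes "0 < \<alpha>" "\<And>i. 0 < a $ i \<and> a $ i < 1"
    and "gamma_distribution \<alpha> (diag_mat (\<chi> i. 1 - (a $ i)\<^sup>2) + outer_prod a a) M"
  shows "MTP2 (joint_cdf M)"
proof -
  have "joint_cdf M = joint_cdf (gamma_mixture \<alpha> a)"
    using assms(3) gamma_distribution_gamma_mixture[OF assms(1,2)]
    by (intro joint_cdf_eq_of_laplace_eq) (auto simp: gamma_distribution_def)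
  with MTP2_joint_cdf_gamma_mixture[OF assms(1,2)] show ?thesis by simp
qed

theorem mainTheorem2:
  fixes a :: "real ^ 'n" and R :: "real ^ 'n ^ 'n" and \<alpha> :: real
  assumes "2 \<le> CARD('n)"
    and "\<And>i. 0 < a $ i \<and> a $ i < 1"
    and "R = diag_mat (\<chi> i. 1 - (a $ i)\<^sup>2) + outer_prod a a"
    and "0 < \<alpha>"
  shows "(\<exists>M. gamma_distribution \<alpha> R M) \<and>
    (\<forall>M. gamma_distribution \<alpha> R M \<longrightarrow> MTP2 (joint_cdf M)) \<and>
    (\<forall>(\<Omega> :: 'w measure) (X :: 'w \<Rightarrow> real ^ 'n) (x :: real ^ 'n) (b :: real ^ 'n)
        (I :: 'n set) (A :: 'n \<Rightarrow> 'w set) (B :: 'n \<Rightarrow> 'w set).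
       prob_space \<Omega> \<longrightarrow> X \<in> borel_measurable \<Omega> \<longrightarrow>
       gamma_distribution \<alpha> R (distr \<Omega> borel X) \<longrightarrow>
       (\<forall>i. 0 < x $ i \<and> x $ i \<le> b $ i) \<longrightarrow> I \<noteq> {} \<longrightarrow> I \<noteq> UNIV \<longrightarrow>
       A = (\<lambda>i. {\<omega> \<in> space \<Omega>. X \<omega> $ i \<le> x $ i}) \<longrightarrow>
       B = (\<lambda>i. {\<omega> \<in> space \<Omega>. X \<omega> $ i \<le> b $ i}) \<longrightarrow>
       measure \<Omega> (\<Inter>i. A i) / (measure \<Omega> (\<Inter>i\<in>I. A i) * measure \<Omega> (\<Inter>i\<in>- I. A i))
       \<ge> measure \<Omega> (\<Inter>i. B i) / (measure \<Omega> (\<Inter>i\<in>I. B i) * measure \<Omega> (\<Inter>i\<in>- I. B i)))"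
proof (intro conjI allI impI)
  show "\<exists>M. gamma_distribution \<alpha> R M"
    using gamma_distribution_gamma_mixture[of \<alpha> a] assms by blast
  show MTP2: "MTP2 (joint_cdf M)" if "gamma_distribution \<alpha> R M" for M
    using gamma_distribution_MTP2[of \<alpha> a M] assms that by simp
  fix \<Omega> :: "'w measure" and X :: "'w \<Rightarrow> real ^ 'n" and x b :: "real ^ 'n" and I :: "'n set"
    and A B :: "'n \<Rightarrow> 'w set"
  assume H: "prob_space \<Omega>" "X \<in> borel_measurable \<Omega>" "gamma_distribution \<alpha> R (distr \<Omega> borel X)"
    "\<forall>i. 0 < x $ i \<and> x $ i \<le> b $ i" "I \<noteq> {}" "I \<noteq> UNIV"
    and A: "A = (\<lambda>i. {\<omega> \<in> space \<Omega>. X \<omega> $ i \<le> x $ i})"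
    and B: "B = (\<lambda>i. {\<omega> \<in> space \<Omega>. X \<omega> $ i \<le> b $ i})"
  show "measure \<Omega> (\<Inter>i. B i) / (measure \<Omega> (\<Inter>i\<in>I. B i) * measure \<Omega> (\<Inter>i\<in>- I. B i))
      \<le> measure \<Omega> (\<Inter>i. A i) / (measure \<Omega> (\<Inter>i\<in>I. A i) * measure \<Omega> (\<Inter>i\<in>- I. A i))"
    unfolding A B using H by (intro orthant_ratio_le_of_MTP2 MTP2) auto
qed

end
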